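(* Suppose that the asymptotic normality assumption (A) described in the context holds, and that $s>0$ and $n_1,\dots,n_k$ are such that $$\frac1k\sum_{i=1}^k\Big(g_i(n_i)+\sqrt{\tfrac{s}{k}}\Big)\cdot\max_{j=1,\dots,k}\alpha_j<\frac12 .$$ For $j=1,\dots,k$ let $\zeta_j(n_j,s)$ be the solution of the equation $$\Phi\Big(\zeta_j(n_j,s)/\sigma^{(j)}_{n_j}\Big)-\frac12=\alpha_j\cdot\frac1k\sum_{i=1}^k\Big(g_i(n_i)+\sqrt{\tfrac{s}{k}}\Big).$$ Let $\widehat\theta^{(k)}=\mathrm{med}(\bar\theta_1,\dots,\bar\theta_k)$ be the sample median of $\bar\theta_1,\dots,\bar\theta_k$. Then for all such $s$, $$\big|\widehat\theta^{(k)}-\theta_\ast\big|\le \zeta(s):=\max_{j=1,\dots,k}\zeta_j(n_j,s)$$ with probability at least $1-4e^{-2s}$.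
   Context: Setting. $X_1,\dots,X_N$ are independent (not necessarily identically distributed) random variables with values in a measurable space $S$, with distributions $P_1,\dots,P_N$ sharing a common parameter $\theta_\ast\in\mathbb R$. The data are partitioned, independently of the data, into disjoint groups $G_1,\dots,G_k$ with cardinalities $n_j=\mathrm{card}(G_j)$, $\sum_{j=1}^k n_j=N$. For each $j$, $\bar\theta_j=\bar\theta_j(G_j)$ is a real-valued estimator of $\theta_\ast$ computed from the group $G_j$; the $\bar\theta_1,\dots,\bar\theta_k$ are independent. $\Phi$ is the cumulative distribution function of the standard normal law $N(0,1)$. Assumption (A). For each $j=1,\dots,k$ (viewing $\bar\theta_j$ as an estimator defined for every group size) there is a sequence $\{\sigma^{(j)}_n\}_{n\in\mathbb N}$ of positive numbers such that $$g_j(n_j):=\sup_{t\in\mathbb R}\Big|\mathbb P\Big(\frac{\bar\theta_j-\theta_\ast}{\sigma^{(j)}_{n_j}}\le t\Big)-\Phi(t)\Big|\to0\quad\text{as } n_j\to\infty .$$ Notation. $H_k=\Big(\frac1k\sum_{j=1}^k\frac1{\sigma^{(j)}_{n_j}}\Big)^{-1}$ is the harmonic mean of the $\sigma^{(j)}_{n_j}$, and $\alpha_j=H_k/\sigma^{(j)}_{n_j}$, so that $\sum_{j=1}^k\alpha_j=k$. *)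

theory Defs
  imports "HOL-Probability.Probability"
begin

definition std_normal_cdf :: "real \<Rightarrow> real" where
  "std_normal_cdf = cdf std_normal_distribution"

text \<open>The uniform (Kolmogorov) distance between the distribution function of \<open>Y\<close> and that of
  \<open>N(0,1)\<close>. The supremum is over a nonempty set bounded by 1 as soon as \<open>M\<close> is a probability space.\<close>

definition normal_approx_error :: "'a measure \<Rightarrow> ('a \<Rightarrow> real) \<Rightarrow> real" where
  "normal_approx_error M Y =
     (SUP t. \<bar>measure M {\<omega> \<in> space M. Y \<omega> \<le> t} - std_normal_cdf t\<bar>)"

text \<open>For odd length the two indices coincide and the result is the middle order statistic;
  for even length it is the mean of the two middle ones.\<close>

definition sample_median :: "real list \<Rightarrow> real" where
  "sample_median xs =
     (sort xs ! ((length xs - 1) div 2) + sort xs ! (length xs div 2)) / 2"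

end

theory Submission
  imports Defs
begin

text \<open>If the median exceeds \<open>theta + \<zeta>\<close>, then at least half of the estimators do. The number of such
  estimators is a sum of independent indicators, whose expectations are by the normal approximation
  at most \<open>1/2 - \<alpha>\<^sub>j c + g\<^sub>j\<close>, where \<open>c\<close> is the mean of the \<open>g\<^sub>i + sqrt (s/k)\<close>. As the \<open>\<alpha>\<^sub>j\<close> sum to
  \<open>k\<close>, the expected number is at most \<open>k/2 - sqrt (s k)\<close>, and Hoeffding's inequality bounds
  the probability by \<open>exp (-2s)\<close>. The lower tail is symmetric.\<close>

section \<open>The standard normal distribution function\<close>

interpretation std_normal: real_distribution std_normal_distribution
  by (rule real_dist_normal_dist)

lemma measure_std_normal_singleton: "measure std_normal_distribution {x} = 0"
proof -
  have "AE y in lborel. y \<in> {x} \<longrightarrow> ennreal (std_normal_density y) = 0"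
    using AE_lborel_singleton[of x] by eventually_elim simp
  hence "{x} \<in> null_sets std_normal_distribution"
    by (subst null_sets_density_iff) simp_all
  thus ?thesis by (simp add: measure_eq_0_null_sets)
qed

lemma isCont_std_normal_cdf: "isCont std_normal_cdf x"
  unfolding std_normal_cdf_def
  by (simp add: std_normal.isCont_cdf measure_std_normal_singleton)

text \<open>The density is positive everywhere, so a half-open interval that is null for the normal
  law would be null for Lebesgue measure as well. Strictness makes the equation defining each
  \<open>\<zeta> j\<close> have at most one solution.\<close>

lemma std_normal_cdf_less:
  assumes "a < b"
  shows "std_normal_cdf a < std_normal_cdf b"
proof -
  have "measure std_normal_distribution {a<..b} \<noteq> 0"
  proof
    assume "measure std_normal_distribution {a<..b} = 0"
    hence "{a<..b} \<in> null_sets std_normal_distribution"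
      by (simp add: std_normal.emeasure_eq_measure null_sets_def)
    hence "AE x in lborel. x \<in> {a<..b} \<longrightarrow> ennreal (std_normal_density x) = 0"
      by (subst (asm) null_sets_density_iff) auto
    hence "AE x in lborel. x \<notin> {a<..b}"
    proof eventually_elim
      case (elim x)
      with normal_density_pos[of 1 0 x] show ?case by auto
    qed
    hence "emeasure lborel {x. a < x \<and> x \<le> b} = 0"
      by (subst (asm) AE_iff_null) (auto simp: null_sets_def)
    also have "{x. a < x \<and> x \<le> b} = {a<..b}" by auto
    finally have "emeasure lborel {a<..b} = 0" .
    with assms show False by simp
  qed
  with std_normal.cdf_diff_eq[OF assms] show ?thesis
    unfolding std_normal_cdf_def by (smt (verit) measure_nonneg)
qed

lemma std_normal_cdf_le_iff: "std_normal_cdf a \<le> std_normal_cdf b \<longleftrightarrow> a \<le> b"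
  using std_normal_cdf_less[of a b] std_normal_cdf_less[of b a] by (cases a b rule: linorder_cases) auto

lemma std_normal_cdf_eq_iff: "std_normal_cdf a = std_normal_cdf b \<longleftrightarrow> a = b"
  by (simp add: order_eq_iff std_normal_cdf_le_iff)

text \<open>Lebesgue measure is invariant under reflection and the density is even.\<close>

lemma std_normal_distribution_uminus:
  "distr std_normal_distribution borel uminus = std_normal_distribution"
proof -
  have "std_normal_distribution = density (distr lborel borel uminus) std_normal_density"
    by (simp add: lborel_distr_uminus)
  also have "\<dots> = distr (density lborel (\<lambda>x. ennreal (std_normal_density (- x)))) borel uminus"
    by (rule density_distr) auto
  finally show ?thesis by (simp add: normal_density_def)
qed

text \<open>Reflection sends \<open>{..- x}\<close> to \<open>{x..}\<close>; since points have
  measure zero, the complement \<open>{..<x}\<close> has the same measure as \<open>{..x}\<close>.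
  This serves the lower tail.\<close>

lemma std_normal_cdf_uminus: "std_normal_cdf (- x) = 1 - std_normal_cdf x"
proof -
  have "std_normal_cdf (- x) = measure (distr std_normal_distribution borel uminus) {..- x}"
    by (simp add: std_normal_distribution_uminus std_normal_cdf_def cdf_def)
  also have "\<dots> = measure std_normal_distribution {x..}"
    by (subst measure_distr) (auto intro!: arg_cong[where f = "measure _"])
  also have "\<dots> = measure std_normal_distribution (space std_normal_distribution - {..<x})"
    by (intro arg_cong[where f = "measure _"]) auto
  also have "\<dots> = 1 - measure std_normal_distribution {..<x}"
    by (rule std_normal.prob_compl) auto
  also have "measure std_normal_distribution {..<x} = std_normal_cdf x"
  proof -
    have "measure std_normal_distribution ({..<x} \<union> {x}) = measure std_normal_distribution {..<x} + measure std_normal_distribution {x}"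
      by (rule std_normal.finite_measure_Union) auto
    moreover have "{..<x} \<union> {x} = {..x}" by auto
    ultimately show ?thesis
      by (simp add: measure_std_normal_singleton std_normal_cdf_def cdf_def)
  qed
  finally show ?thesis .
qed

text \<open>Intermediate value theorem between the limits 0 and 1. It supplies the existence of each
  \<open>\<zeta> j\<close>.\<close>

lemma std_normal_cdf_surj:
  assumes "0 < p" "p < 1"
  obtains z where "std_normal_cdf z = p"
proof -
  have "eventually (\<lambda>x. std_normal_cdf x < p) at_bot"
    using order_tendstoD(2)[OF std_normal.cdf_lim_at_bot assms(1)] by (simp add: std_normal_cdf_def)
  then obtain a where a: "std_normal_cdf a < p"
    using eventually_happens' trivial_limit_at_bot_linorder by blast
  have "eventually (\<lambda>x. std_normal_cdf x > p) at_top"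
    using order_tendstoD(1)[OF std_normal.cdf_lim_at_top_prob assms(2)] by (simp add: std_normal_cdf_def)
  then obtain b where b: "std_normal_cdf b > p"
    using eventually_happens' trivial_limit_at_top_linorder by blast
  have "a \<le> b" using a b std_normal_cdf_le_iff[of a b] by linarith
  with a b have "\<exists>x. a \<le> x \<and> x \<le> b \<and> std_normal_cdf x = p"
    by (intro IVT') (auto intro!: continuous_at_imp_continuous_on isCont_std_normal_cdf)
  thus thesis using that by blast
qed

text \<open>A real supremum bounds its members only when the set is bounded above; here 1 is a
  bound, because both terms of the difference lie in [0,1].\<close>

lemma (in prob_space) normal_approx_error_upper:
  "\<bar>prob {\<omega> \<in> space M. Y \<omega> \<le> t} - std_normal_cdf t\<bar> \<le> normal_approx_error M Y"
  unfolding normal_approx_error_def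
proof (rule cSUP_upper)
  show "bdd_above (range (\<lambda>t. \<bar>prob {\<omega> \<in> space M. Y \<omega> \<le> t} - std_normal_cdf t\<bar>))"
  proof (rule bdd_aboveI2)
    fix t
    show "\<bar>prob {\<omega> \<in> space M. Y \<omega> \<le> t} - std_normal_cdf t\<bar> \<le> 1"
      using prob_le_1[of "{\<omega> \<in> space M. Y \<omega> \<le> t}"] measure_nonneg[of M "{\<omega> \<in> space M. Y \<omega> \<le> t}"]
        std_normal.cdf_bounded_prob[of t] std_normal.cdf_nonneg[of t]
      unfolding std_normal_cdf_def by linarith
  qed
qed simp

section \<open>The sample median\<close>

lemma length_filter_sort:
  "length (filter P (sort xs)) = length (filter P xs)"
  by (simp add: filter_sort)

text \<open>In a sorted list the positions with value at most \<open>c\<close> form an initial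
  segment, so position \<open>i\<close> belongs to it exactly when its length exceeds
  \<open>i\<close>. This turns order statistics into counts.\<close>

lemma sort_nth_le_iff:
  assumes "i < length xs"
  shows "sort xs ! i \<le> c \<longleftrightarrow> i < length (filter (\<lambda>x. x \<le> c) xs)"
proof -
  let ?A = "{j. j < length xs \<and> sort xs ! j \<le> c}"
  have card: "length (filter (\<lambda>x. x \<le> c) xs) = card ?A"
    using length_filter_conv_card[of "\<lambda>x. x \<le> c" "sort xs"] by (simp add: length_filter_sort)
  show ?thesis
  proof
    assume le: "sort xs ! i \<le> c"
    have "{..i} \<subseteq> ?A"
      using assms le by (auto intro: order_trans[OF sorted_nth_mono])
    hence "card {..i} \<le> card ?A" by (intro card_mono) auto
    thus "i < length (filter (\<lambda>x. x \<le> c) xs)" by (simp add: card)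
  next
    assume less: "i < length (filter (\<lambda>x. x \<le> c) xs)"
    show "sort xs ! i \<le> c"
    proof (rule ccontr)
      assume gt: "\<not> sort xs ! i \<le> c"
      have "?A \<subseteq> {..<i}"
      proof
        fix j assume j: "j \<in> ?A"
        hence "\<not> i \<le> j"
          using gt sorted_nth_mono[of "sort xs" i j] by auto
        thus "j \<in> {..<i}" by simp
      qed
      hence "card ?A \<le> card {..<i}" by (intro card_mono) auto
      with less card show False by simp
    qed
  qed
qed

text \<open>The larger middle entry, at index \<open>?h\<close>, is at least the median and so
  exceeds \<open>c\<close>. Hence at most \<open>?h\<close> entries, no more than half, are at most
  \<open>c\<close>.\<close>

lemma sample_median_greater:
  assumes "sample_median xs > c"
  shows "length xs \<le> 2 * length (filter (\<lambda>x. x > c) xs)"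
proof (cases "xs = []")
  case False
  let ?h = "length xs div 2"
  from False have h: "?h < length xs" by (cases xs) auto
  have "sort xs ! ((length xs - 1) div 2) \<le> sort xs ! ?h"
    using h by (intro sorted_nth_mono div_le_mono) auto
  with assms have "sort xs ! ?h > c" by (simp add: sample_median_def)
  hence "length (filter (\<lambda>x. x \<le> c) xs) \<le> ?h"
    using sort_nth_le_iff[OF h, of c] by simp
  thus ?thesis
    using sum_length_filter_compl[of "\<lambda>x. x \<le> c" xs] by (simp add: not_le)
qed simp

lemma sample_median_less:
  assumes "sample_median xs < c"
  shows "length xs \<le> 2 * length (filter (\<lambda>x. x < c) xs)"
proof (cases "xs = []")
  case False
  let ?l = "(length xs - 1) div 2"
  from False have l: "?l < length xs" "length xs div 2 < length xs" by (cases xs; auto)+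
  have "sort xs ! ?l \<le> sort xs ! (length xs div 2)"
    using l by (intro sorted_nth_mono div_le_mono) auto
  with assms have less: "sort xs ! ?l < c" by (simp add: sample_median_def)
  \<comment> \<open>The counting criterion is non-strict while the claim is strict. Taking the
    smaller middle entry itself as threshold gives at least \<open>?l + 1\<close> entries not above
    it, all of them below \<open>c\<close>, and \<open>?l + 1\<close> is at least half the length
    for either parity.\<close>
  have "?l < length (filter (\<lambda>x. x \<le> sort xs ! ?l) xs)"
    using sort_nth_le_iff[OF l(1), of "sort xs ! ?l"] by simp
  also have "\<dots> \<le> length (filter (\<lambda>x. x < c) xs)"
  proof -
    have "filter (\<lambda>x. x \<le> sort xs ! ?l) xs = filter (\<lambda>x. x \<le> sort xs ! ?l) (filter (\<lambda>x. x < c) xs)"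
      using less by (auto intro: filter_cong)
    thus ?thesis by (metis length_filter_le)
  qed
  finally show ?thesis by linarith
qed simp

lemma borel_measurable_length_filter_map:
  assumes "\<And>j. j \<in> set js \<Longrightarrow> {\<omega> \<in> space M. Q j \<omega>} \<in> sets M"
  shows "(\<lambda>\<omega>. real (length (filter (\<lambda>j. Q j \<omega>) js))) \<in> borel_measurable M"
  using assms
proof (induction js)
  case (Cons j js)
  have [measurable]: "Measurable.pred M (Q j)" using Cons.prems by (simp add: pred_def)
  have [measurable]: "(\<lambda>\<omega>. real (length (filter (\<lambda>j. Q j \<omega>) js))) \<in> borel_measurable M"
    using Cons by simp
  have "(\<lambda>\<omega>. real (length (filter (\<lambda>j. Q j \<omega>) (j # js)))) =
      (\<lambda>\<omega>. (if Q j \<omega> then 1 else 0) + real (length (filter (\<lambda>j. Q j \<omega>) js)))"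
    by auto
  thus ?case by simp
qed simp

text \<open>A sublevel set of an order statistic is an event about how many of the variables are at
  most \<open>c\<close>, and that count is measurable.\<close>

lemma borel_measurable_sort_nth:
  fixes Y :: "'b \<Rightarrow> 'a \<Rightarrow> real"
  assumes Y: "\<And>j. j \<in> set js \<Longrightarrow> Y j \<in> borel_measurable M" and i: "i < length js"
  shows "(\<lambda>\<omega>. sort (map (\<lambda>j. Y j \<omega>) js) ! i) \<in> borel_measurable M"
  unfolding borel_measurable_iff_le
proof
  fix c
  have [measurable]: "(\<lambda>\<omega>. real (length (filter (\<lambda>j. Y j \<omega> \<le> c) js))) \<in> borel_measurable M"
    using Y by (intro borel_measurable_length_filter_map) (simp add: borel_measurable_iff_le)
  have "{\<omega> \<in> space M. sort (map (\<lambda>j. Y j \<omega>) js) ! i \<le> c} =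
      {\<omega> \<in> space M. real i < real (length (filter (\<lambda>j. Y j \<omega> \<le> c) js))}"
    using i by (simp add: sort_nth_le_iff filter_map comp_def)
  also have "\<dots> \<in> sets M" by measurable
  finally show "{\<omega> \<in> space M. sort (map (\<lambda>j. Y j \<omega>) js) ! i \<le> c} \<in> sets M" .
qed

lemma borel_measurable_sample_median:
  fixes Y :: "'b \<Rightarrow> 'a \<Rightarrow> real"
  assumes "\<And>j. j \<in> set js \<Longrightarrow> Y j \<in> borel_measurable M" and "js \<noteq> []"
  shows "(\<lambda>\<omega>. sample_median (map (\<lambda>j. Y j \<omega>) js)) \<in> borel_measurable M"
proof -
  have "(length js - 1) div 2 < length js" "length js div 2 < length js"
    using assms(2) by (cases js; auto)+
  with assms(1) have
    "(\<lambda>\<omega>. sort (map (\<lambda>j. Y j \<omega>) js) ! ((length js - 1) div 2)) \<in> borel_measurable M"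
    "(\<lambda>\<omega>. sort (map (\<lambda>j. Y j \<omega>) js) ! (length js div 2)) \<in> borel_measurable M"
    by (auto intro: borel_measurable_sort_nth)
  thus ?thesis
    unfolding sample_median_def length_map by (intro borel_measurable_divide borel_measurable_add) simp_all
qed

section \<open>Concentration and independence\<close>

text \<open>The indicators of \<open>A\<close> have expected sum at least \<open>\<epsilon>\<close>
  below half their number, so a majority is an upward deviation by at least
  \<open>\<epsilon>\<close>. Each range has length 1, hence the denominator
  \<open>card I\<close>.\<close>

lemma (in prob_space) prob_half_le_Hoeffding:
  fixes Y :: "'b \<Rightarrow> 'a \<Rightarrow> real"
  assumes indep: "indep_vars (\<lambda>_. borel) Y I" and fin: "finite I" and "I \<noteq> {}"
    and [measurable]: "A \<in> sets borel" and "\<epsilon> \<ge> 0"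
    and le: "(\<Sum>j\<in>I. prob {\<omega> \<in> space M. Y j \<omega> \<in> A}) \<le> card I / 2 - \<epsilon>"
  shows "prob {\<omega> \<in> space M. card I \<le> 2 * card {j \<in> I. Y j \<omega> \<in> A}} \<le> exp (- 2 * \<epsilon>\<^sup>2 / card I)"
    and "{\<omega> \<in> space M. card I \<le> 2 * card {j \<in> I. Y j \<omega> \<in> A}} \<in> events"
proof -
  have [measurable]: "random_variable borel (Y j)" if "j \<in> I" for j
    using indep that unfolding indep_vars_def by blast
  define B where "B = (\<lambda>j \<omega>. indicator A (Y j \<omega>) :: real)"
  interpret Hoeffding_ineq M I B "\<lambda>_. 0" "\<lambda>_. 1" "\<Sum>j\<in>I. expectation (B j)"
  proof unfold_locales
    show "indep_vars (\<lambda>_. borel) B I"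
      unfolding B_def by (rule indep_vars_compose2[OF indep]) auto
  qed (auto simp: fin B_def indicator_def)
  have "expectation (B j) = prob {\<omega> \<in> space M. Y j \<omega> \<in> A}" if "j \<in> I" for j
  proof -
    have "expectation (B j) = expectation (indicator {\<omega> \<in> space M. Y j \<omega> \<in> A})"
      unfolding B_def by (intro Bochner_Integration.integral_cong) (auto simp: indicator_def)
    thus ?thesis using that by simp
  qed
  hence mu: "(\<Sum>j\<in>I. expectation (B j)) + \<epsilon> \<le> card I / 2" using le by simp
  have B_sum: "(\<Sum>j\<in>I. B j \<omega>) = card {j \<in> I. Y j \<omega> \<in> A}" for \<omega>
    by (simp add: B_def indicator_def fin sum.If_cases Int_def)
  have ev: "{\<omega> \<in> space M. card I \<le> 2 * card {j \<in> I. Y j \<omega> \<in> A}} =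
      {\<omega> \<in> space M. card I / 2 \<le> (\<Sum>j\<in>I. B j \<omega>)}"
    unfolding B_sum by (auto simp: field_simps)
  show "{\<omega> \<in> space M. card I \<le> 2 * card {j \<in> I. Y j \<omega> \<in> A}} \<in> events"
    unfolding ev by measurable
  have "prob {\<omega> \<in> space M. card I / 2 \<le> (\<Sum>j\<in>I. B j \<omega>)} \<le>
      prob {\<omega> \<in> space M. (\<Sum>j\<in>I. B j \<omega>) \<ge> (\<Sum>j\<in>I. expectation (B j)) + \<epsilon>}"
    using mu by (intro finite_measure_mono) auto
  also have "\<dots> \<le> exp (- 2 * \<epsilon>\<^sup>2 / (\<Sum>i\<in>I. (1 - 0)\<^sup>2))"
    using assms by (intro Hoeffding_ineq_ge) (auto simp: card_gt_0_iff)
  finally show "prob {\<omega> \<in> space M. card I \<le> 2 * card {j \<in> I. Y j \<omega> \<in> A}} \<le> exp (- 2 * \<epsilon>\<^sup>2 / card I)"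
    unfolding ev by simp
qed

text \<open>The empty family is treated separately because groups of size zero are allowed; both
  sides are then the unit mass at the only function, \<open>\<lambda>_. undefined\<close>.\<close>

lemma (in prob_space) distr_restrict_eq_PiM:
  assumes indep: "indep_vars M' X I"
  shows "distr M (Pi\<^sub>M I M') (\<lambda>\<omega>. \<lambda>i\<in>I. X i \<omega>) = Pi\<^sub>M I (\<lambda>i. distr M (M' i) (X i))"
proof (cases "I = {}")
  case True
  have "distr M (count_space {\<lambda>_. undefined}) (\<lambda>\<omega>. \<lambda>i\<in>{}. X i \<omega>) = count_space {\<lambda>_. undefined}"
  proof (rule measure_eqI)
    fix A assume "A \<in> sets (distr M (count_space {\<lambda>_. undefined}) (\<lambda>\<omega>. \<lambda>i\<in>{}. X i \<omega>))"
    hence "A = {} \<or> A = {\<lambda>_. undefined}" by auto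
    moreover have "emeasure (distr M (count_space {\<lambda>_. undefined}) (\<lambda>\<omega>. \<lambda>i\<in>{}. X i \<omega>)) {\<lambda>_. undefined} = 1"
      by (subst emeasure_distr) (auto simp: restrict_def emeasure_space_1)
    ultimately show "emeasure (distr M (count_space {\<lambda>_. undefined}) (\<lambda>\<omega>. \<lambda>i\<in>{}. X i \<omega>)) A =
        emeasure (count_space {\<lambda>_. undefined}) A"
      by (elim disjE) simp_all
  qed simp
  with True show ?thesis by (simp add: PiM_empty)
next
  case False
  have "random_variable (M' i) (X i)" if "i \<in> I" for i
    using indep that unfolding indep_vars_def by blast
  from indep_vars_iff_distr_eq_PiM'[OF False this] indep show ?thesis
    by simp
qed

theorem theorem1:
  fixes M :: "'w measure" and S :: "'s measure"
    and X :: "nat \<Rightarrow> 'w \<Rightarrow> 's" and P :: "nat \<Rightarrow> 's measure"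
    and param :: "'s measure \<Rightarrow> real" and theta :: real
    and N k :: nat and n :: "nat \<Rightarrow> nat"
    and G :: "nat \<Rightarrow> nat \<Rightarrow> nat set"
    and T :: "nat \<Rightarrow> nat \<Rightarrow> (nat \<Rightarrow> 's) \<Rightarrow> real"
    and theta_bar :: "nat \<Rightarrow> 'w \<Rightarrow> real"
    and \<sigma> g :: "nat \<Rightarrow> nat \<Rightarrow> real"
    and H s :: real and \<alpha> \<zeta> :: "nat \<Rightarrow> real"
  (* the data X_1, ..., X_N; the P_i with i > N serve as laws of the data in hypothetical larger groups *)
  assumes "prob_space M"
    and "\<And>i. prob_space (P i)" and "\<And>i. sets (P i) = sets S" and "\<And>i. param (P i) = theta"
    and "prob_space.indep_vars M (\<lambda>_. S) X {1..N}"
    and "\<And>i. i \<in> {1..N} \<Longrightarrow> distr M S (X i) = P i"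
  (* G j m: the index set of the j-th group when it has size m; the actual groups are G j (n j) *)
    and "k \<ge> 1"
    and "\<And>j m. j \<in> {1..k} \<Longrightarrow> finite (G j m) \<and> card (G j m) = m"
    and "disjoint_family_on (\<lambda>j. G j (n j)) {1..k}"
    and "(\<Union>j\<in>{1..k}. G j (n j)) = {1..N}"
  (* T j m: the j-th estimator, as a function of the data of a group of size m *)
    and "\<And>j m. j \<in> {1..k} \<Longrightarrow> T j m \<in> borel_measurable (Pi\<^sub>M (G j m) (\<lambda>_. S))"
    and "\<And>j \<omega>. theta_bar j \<omega> = T j (n j) (\<lambda>i\<in>G j (n j). X i \<omega>)"
    and "prob_space.indep_vars M (\<lambda>_. borel) theta_bar {1..k}"
  (* asymptotic normality *)
    and "\<And>j m. j \<in> {1..k} \<Longrightarrow> \<sigma> j m > 0"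
    and "\<And>j m. g j m =
           normal_approx_error (Pi\<^sub>M (G j m) P) (\<lambda>x. (T j m x - theta) / \<sigma> j m)"
    and "\<And>j. j \<in> {1..k} \<Longrightarrow> (\<lambda>m. g j m) \<longlonglongrightarrow> 0"
  (* harmonic mean and weights *)
    and "H = inverse (1 / real k * (\<Sum>j=1..k. 1 / \<sigma> j (n j)))"
    and "\<And>j. \<alpha> j = H / \<sigma> j (n j)"
    and "s > 0"
    and "1 / real k * (\<Sum>i=1..k. g i (n i) + sqrt (s / real k)) * (MAX j\<in>{1..k}. \<alpha> j) < 1 / 2"
    and "\<And>j. \<zeta> j = (THE z. std_normal_cdf (z / \<sigma> j (n j)) - 1 / 2 =
           \<alpha> j * (1 / real k) * (\<Sum>i=1..k. g i (n i) + sqrt (s / real k)))"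
  shows "measure M {\<omega> \<in> space M.
           \<bar>sample_median (map (\<lambda>j. theta_bar j \<omega>) [1..<k+1]) - theta\<bar> \<le> (MAX j\<in>{1..k}. \<zeta> j)}
         \<ge> 1 - 4 * exp (- 2 * s)"
proof -
  interpret prob_space M by fact
  note k = assms(7) and sigma_pos = assms(14) and s = assms(19)
  have ne: "{1..k} \<noteq> {}" using k by simp

  \<comment> \<open>Transfer of the normal approximation to the actual groups\<close>
  have rv [measurable]: "theta_bar j \<in> borel_measurable M" if "j \<in> {1..k}" for j
    using assms(13) that unfolding indep_vars_def by blast
  \<comment> \<open>The error \<open>g\<close> is computed under a product of the laws
    \<open>P i\<close>, since it also refers to hypothetical group sizes. For the actual group,
    independence identifies this product with the joint law of its data.\<close>
  have law: "prob {\<omega> \<in> space M. (theta_bar j \<omega> - theta) / \<sigma> j (n j) \<le> t} =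
      measure (Pi\<^sub>M (G j (n j)) P)
        {x \<in> space (Pi\<^sub>M (G j (n j)) P). (T j (n j) x - theta) / \<sigma> j (n j) \<le> t}"
    if j: "j \<in> {1..k}" for j t
  proof -
    let ?G = "G j (n j)" and ?X = "\<lambda>\<omega>. \<lambda>i\<in>G j (n j). X i \<omega>"
    have sub: "?G \<subseteq> {1..N}" using assms(10) j by blast
    have indep: "indep_vars (\<lambda>_. S) X ?G" by (rule indep_vars_subset[OF assms(5) sub])
    have X [measurable]: "X i \<in> M \<rightarrow>\<^sub>M S" if "i \<in> ?G" for i
      using indep that unfolding indep_vars_def by blast
    have [measurable]: "?X \<in> M \<rightarrow>\<^sub>M Pi\<^sub>M ?G (\<lambda>_. S)" by (rule measurable_restrict) (rule X)
    have [measurable]: "T j (n j) \<in> borel_measurable (Pi\<^sub>M ?G (\<lambda>_. S))" by (rule assms(11)[OF j])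
    have "Pi\<^sub>M ?G P = Pi\<^sub>M ?G (\<lambda>i. distr M S (X i))"
      using sub assms(6) by (intro PiM_cong) auto
    also have "\<dots> = distr M (Pi\<^sub>M ?G (\<lambda>_. S)) ?X"
      by (rule distr_restrict_eq_PiM[OF indep, symmetric])
    finally have PiM: "Pi\<^sub>M ?G P = distr M (Pi\<^sub>M ?G (\<lambda>_. S)) ?X" .
    have "measure (Pi\<^sub>M ?G P) {x \<in> space (Pi\<^sub>M ?G P). (T j (n j) x - theta) / \<sigma> j (n j) \<le> t} =
        prob (?X -` {x \<in> space (Pi\<^sub>M ?G (\<lambda>_. S)). (T j (n j) x - theta) / \<sigma> j (n j) \<le> t} \<inter> space M)"
      unfolding PiM space_distr by (rule measure_distr) measurable
    also have "?X -` {x \<in> space (Pi\<^sub>M ?G (\<lambda>_. S)). (T j (n j) x - theta) / \<sigma> j (n j) \<le> t} \<inter> space M =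
        {\<omega> \<in> space M. (theta_bar j \<omega> - theta) / \<sigma> j (n j) \<le> t}"
      using measurable_space[OF \<open>?X \<in> M \<rightarrow>\<^sub>M Pi\<^sub>M ?G (\<lambda>_. S)\<close>] by (auto simp: assms(12))
    finally show ?thesis by simp
  qed
  have approx: "\<bar>prob {\<omega> \<in> space M. (theta_bar j \<omega> - theta) / \<sigma> j (n j) \<le> t} - std_normal_cdf t\<bar>
      \<le> g j (n j)" if "j \<in> {1..k}" for j t
    unfolding assms(15) law[OF that]
    by (rule prob_space.normal_approx_error_upper) (intro prob_space_PiM assms(2))
  have g_nonneg: "g j (n j) \<ge> 0" if "j \<in> {1..k}" for j
    using approx[OF that, of 0] by linarith

  \<comment> \<open>The weights and the thresholds \<open>\<zeta> j\<close>\<close>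
  define c where "c = 1 / real k * (\<Sum>i=1..k. g i (n i) + sqrt (s / real k))"
  define z where "z = (MAX j\<in>{1..k}. \<zeta> j)"
  have kc: "real k * c = (\<Sum>i=1..k. g i (n i)) + sqrt (s * k)"
  proof -
    have "sqrt (s * k) = sqrt (s / k * (real k)\<^sup>2)"
      using k by (simp add: power2_eq_square)
    also have "\<dots> = k * sqrt (s / k)"
      unfolding real_sqrt_mult by simp
    finally show ?thesis using k by (simp add: c_def sum.distrib)
  qed
  have c_pos: "c > 0"
  proof -
    have "(\<Sum>i=1..k. g i (n i) + sqrt (s / real k)) > 0"
      using g_nonneg s k by (intro sum_pos add_nonneg_pos) auto
    thus ?thesis using k by (simp add: c_def)
  qed
  have inv_sum_pos: "(\<Sum>j=1..k. 1 / \<sigma> j (n j)) > 0"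
    using sigma_pos ne by (intro sum_pos) auto
  have H_pos: "H > 0" unfolding assms(17) using inv_sum_pos k by simp
  have alpha_pos: "\<alpha> j > 0" if "j \<in> {1..k}" for j
    using H_pos sigma_pos[OF that] by (simp add: assms(18))
  have alpha_sum: "(\<Sum>j=1..k. \<alpha> j) = k"
  proof -
    have "(\<Sum>j=1..k. \<alpha> j) = H * (\<Sum>j=1..k. 1 / \<sigma> j (n j))"
      by (simp add: assms(18) sum_distrib_left)
    also have "\<dots> = k" unfolding assms(17) using inv_sum_pos k by (simp add: field_simps)
    finally show ?thesis .
  qed
  \<comment> \<open>The assumption on the maximal weight, with \<open>c > 0\<close> and positive
    weights, puts the right-hand side strictly between 1/2 and 1. The solution therefore exists and
    is unique, and the description \<open>THE\<close> denotes it.\<close>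
  have cdf_zeta: "std_normal_cdf (\<zeta> j / \<sigma> j (n j)) = 1 / 2 + \<alpha> j * c" if j: "j \<in> {1..k}" for j
  proof -
    have "\<alpha> j * c \<le> (MAX j\<in>{1..k}. \<alpha> j) * c"
      using j c_pos by (intro mult_right_mono Max_ge) auto
    also have "\<dots> < 1 / 2" using assms(20) by (simp add: c_def mult.commute)
    finally have "\<alpha> j * c < 1 / 2" .
    moreover have "\<alpha> j * c > 0" using alpha_pos[OF j] c_pos by simp
    ultimately obtain y where y: "std_normal_cdf y = 1 / 2 + \<alpha> j * c"
      using std_normal_cdf_surj[of "1 / 2 + \<alpha> j * c"] by auto
    have sig: "\<sigma> j (n j) > 0" by (rule sigma_pos[OF j])
    have "\<zeta> j = (THE z. std_normal_cdf (z / \<sigma> j (n j)) - 1 / 2 = \<alpha> j * c)"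
      unfolding assms(21) c_def by (simp add: mult.assoc)
    also have "\<dots> = y * \<sigma> j (n j)"
    proof (rule the_equality)
      show "std_normal_cdf (y * \<sigma> j (n j) / \<sigma> j (n j)) - 1 / 2 = \<alpha> j * c" using y sig by simp
    next
      fix z assume "std_normal_cdf (z / \<sigma> j (n j)) - 1 / 2 = \<alpha> j * c"
      hence "std_normal_cdf (z / \<sigma> j (n j)) = std_normal_cdf y" using y by simp
      thus "z = y * \<sigma> j (n j)" using sig by (simp add: std_normal_cdf_eq_iff field_simps)
    qed
    finally show ?thesis using y sig by simp
  qed
  have cdf_z: "std_normal_cdf (z / \<sigma> j (n j)) \<ge> 1 / 2 + \<alpha> j * c" if j: "j \<in> {1..k}" for j
  proof -
    have "\<zeta> j \<le> z" unfolding z_def using j by (intro Max_ge) auto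
    hence "\<zeta> j / \<sigma> j (n j) \<le> z / \<sigma> j (n j)"
      using sigma_pos[OF j, of "n j"] by (simp add: divide_right_mono)
    thus ?thesis using cdf_zeta[OF j] by (metis std_normal_cdf_le_iff)
  qed

  \<comment> \<open>Tail probabilities of a single estimator\<close>
  have upper: "prob {\<omega> \<in> space M. theta_bar j \<omega> \<in> {theta + z<..}} \<le> 1 / 2 - \<alpha> j * c + g j (n j)"
    if j: "j \<in> {1..k}" for j
  proof -
    have [measurable]: "theta_bar j \<in> borel_measurable M" by (rule rv[OF j])
    have "{\<omega> \<in> space M. theta_bar j \<omega> \<in> {theta + z<..}} =
        space M - {\<omega> \<in> space M. (theta_bar j \<omega> - theta) / \<sigma> j (n j) \<le> z / \<sigma> j (n j)}"
      using sigma_pos[OF j, of "n j"] by (auto simp: divide_le_cancel)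
    hence "prob {\<omega> \<in> space M. theta_bar j \<omega> \<in> {theta + z<..}} =
        1 - prob {\<omega> \<in> space M. (theta_bar j \<omega> - theta) / \<sigma> j (n j) \<le> z / \<sigma> j (n j)}"
      by (simp add: prob_compl)
    thus ?thesis using approx[OF j, of "z / \<sigma> j (n j)"] cdf_z[OF j] by linarith
  qed
  have lower: "prob {\<omega> \<in> space M. theta_bar j \<omega> \<in> {..<theta - z}} \<le> 1 / 2 - \<alpha> j * c + g j (n j)"
    if j: "j \<in> {1..k}" for j
  proof -
    have [measurable]: "theta_bar j \<in> borel_measurable M" by (rule rv[OF j])
    \<comment> \<open>The approximation controls events with a non-strict inequality only, so the
      strict event is enlarged first; the symmetry of the normal law then reduces the bound to
      \<open>cdf_z\<close>.\<close>
    have "prob {\<omega> \<in> space M. theta_bar j \<omega> \<in> {..<theta - z}} \<le>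
        prob {\<omega> \<in> space M. (theta_bar j \<omega> - theta) / \<sigma> j (n j) \<le> - (z / \<sigma> j (n j))}"
    proof (rule finite_measure_mono)
      show "{\<omega> \<in> space M. theta_bar j \<omega> \<in> {..<theta - z}} \<subseteq>
          {\<omega> \<in> space M. (theta_bar j \<omega> - theta) / \<sigma> j (n j) \<le> - (z / \<sigma> j (n j))}"
        using sigma_pos[OF j, of "n j"] by (auto simp: pos_divide_le_eq)
    qed measurable
    thus ?thesis
      using approx[OF j, of "- (z / \<sigma> j (n j))"] cdf_z[OF j] std_normal_cdf_uminus[of "z / \<sigma> j (n j)"]
      by linarith
  qed
  \<comment> \<open>The weights sum to \<open>k\<close>, so the total is \<open>k/2 - k c\<close>
    plus the errors. The errors contained in \<open>k c\<close> cancel these and leave the margin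
    \<open>sqrt (s * k)\<close>.\<close>
  have bound_sum: "(\<Sum>j=1..k. 1 / 2 - \<alpha> j * c + g j (n j)) = k / 2 - sqrt (s * k)"
    using kc alpha_sum by (simp add: sum.distrib sum_subtractf flip: sum_distrib_right)

  \<comment> \<open>The event that at least half of the estimators lie in a given set\<close>
  define E where "E A = {\<omega> \<in> space M. k \<le> 2 * card {j \<in> {1..k}. theta_bar j \<omega> \<in> A}}" for A
  have tail: "prob (E A) \<le> exp (- 2 * s)" and E_event: "E A \<in> events"
    if A: "A \<in> sets borel"
      and le: "\<And>j. j \<in> {1..k} \<Longrightarrow> prob {\<omega> \<in> space M. theta_bar j \<omega> \<in> A} \<le> 1 / 2 - \<alpha> j * c + g j (n j)"
    for A
  proof -
    have "(\<Sum>j\<in>{1..k}. prob {\<omega> \<in> space M. theta_bar j \<omega> \<in> A}) \<le> card {1..k} / 2 - sqrt (s * k)"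
      using sum_mono[OF le, of "{1..k}" "\<lambda>j. j"] bound_sum by simp
    moreover have "sqrt (s * k) \<ge> 0" using s by simp
    ultimately have "prob (E A) \<le> exp (- 2 * (sqrt (s * k))\<^sup>2 / k)" and E: "E A \<in> events"
      using prob_half_le_Hoeffding[OF assms(13) finite_atLeastAtMost ne A, of "sqrt (s * k)"]
      unfolding E_def card_atLeastAtMost diff_Suc_1 by blast+
    \<comment> \<open>The margin \<open>sqrt (s * k)\<close> is just what makes the Hoeffding
      exponent independent of \<open>k\<close>.\<close>
    moreover have "- 2 * (sqrt (s * k))\<^sup>2 / k = - 2 * s" using s k by simp
    ultimately show "prob (E A) \<le> exp (- 2 * s)" by metis
    show "E A \<in> events" by (rule E)
  qed

  \<comment> \<open>From the count to the median\<close>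
  let ?med = "\<lambda>\<omega>. sample_median (map (\<lambda>j. theta_bar j \<omega>) [1..<k+1])"
  have [measurable]: "?med \<in> borel_measurable M"
    using k by (intro borel_measurable_sample_median rv) auto
  \<comment> \<open>The list has no repetitions, so counting list entries is the same as counting
    indices in \<open>{1..k}\<close>.\<close>
  have count: "length (filter Q (map (\<lambda>j. theta_bar j \<omega>) [1..<k+1])) = card {j \<in> {1..k}. Q (theta_bar j \<omega>)}"
    for Q \<omega>
  proof -
    have "length (filter Q (map (\<lambda>j. theta_bar j \<omega>) [1..<k+1])) =
        card (set (filter (\<lambda>j. Q (theta_bar j \<omega>)) [1..<k+1]))"
      by (subst distinct_card) (simp_all add: filter_map comp_def)
    also have "set (filter (\<lambda>j. Q (theta_bar j \<omega>)) [1..<k+1]) = {j \<in> {1..k}. Q (theta_bar j \<omega>)}"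
      by auto
    finally show ?thesis .
  qed
  have "space M - {\<omega> \<in> space M. \<bar>?med \<omega> - theta\<bar> \<le> z} \<subseteq> E {theta + z<..} \<union> E {..<theta - z}"
  proof
    fix \<omega> assume "\<omega> \<in> space M - {\<omega> \<in> space M. \<bar>?med \<omega> - theta\<bar> \<le> z}"
    hence \<omega>: "\<omega> \<in> space M" and "?med \<omega> > theta + z \<or> ?med \<omega> < theta - z" by auto
    from this(2) show "\<omega> \<in> E {theta + z<..} \<union> E {..<theta - z}"
    proof
      assume "?med \<omega> > theta + z"
      from sample_median_greater[OF this] \<omega> k show ?thesis unfolding count by (simp add: E_def)
    next
      assume "?med \<omega> < theta - z"
      from sample_median_less[OF this] \<omega> k show ?thesis unfolding count by (simp add: E_def)
    qed
  qed
  hence "prob (space M - {\<omega> \<in> space M. \<bar>?med \<omega> - theta\<bar> \<le> z}) \<le> prob (E {theta + z<..} \<union> E {..<theta - z})"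
    by (rule finite_measure_mono) (auto intro!: E_event upper lower)
  also have "\<dots> \<le> prob (E {theta + z<..}) + prob (E {..<theta - z})"
    by (rule measure_Un_le) (auto intro!: E_event upper lower)
  also have "\<dots> \<le> exp (- 2 * s) + exp (- 2 * s)"
    by (intro add_mono tail upper lower) auto
  \<comment> \<open>The two tails together cost \<open>2 * exp (- 2 * s)\<close>, which lies within
    the stated constant 4.\<close>
  also have "\<dots> \<le> 4 * exp (- 2 * s)" by simp
  finally have "prob (space M - {\<omega> \<in> space M. \<bar>?med \<omega> - theta\<bar> \<le> z}) \<le> 4 * exp (- 2 * s)" .
  moreover have "prob (space M - {\<omega> \<in> space M. \<bar>?med \<omega> - theta\<bar> \<le> z}) =
      1 - prob {\<omega> \<in> space M. \<bar>?med \<omega> - theta\<bar> \<le> z}"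
    by (rule prob_compl) measurable
  ultimately show ?thesis unfolding z_def by linarith
qed

end
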